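(* Let $f:\mathbb{R}\to\mathbb{R}$ satisfy: (A1) $f$ is locally Lipschitz continuous and $uf(u)>0$ for all $u\neq 0$; (A2) $f$ is differentiable at $0$ with $f'(0)>0$. For $c\in\mathbb{R}$ with $0<c^4<4f'(0)$ let $$L(f,c) = \sup\left\{\delta>0 : \frac{f(v)}{v} > \frac{c^4}{4} \text{ for all } v\in\mathbb{R} \text{ with } 0\neq |v|<\delta\right\}\in(0,\infty].$$ Then $L(f,c)\to\infty$ as $c\to 0$, and nonzero homoclinic solutions of $u''''+c^2u''+f(u)=0$ become unbounded as $c\to 0$; that is, for every $M>0$ there exists $c_0>0$ such that for every $c$ with $0<|c|<c_0$, every nonzero homoclinic solution $u$ of $$u'''' + c^2 u'' + f(u) = 0$$ satisfies $\|u\|_\infty\geq M$.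
   Context: A homoclinic solution of the ODE $u''''+c^2u''+f(u)=0$ is a (classical, four times continuously differentiable) solution $u:\mathbb{R}\to\mathbb{R}$ defined on all of $\mathbb{R}$ with $u(s)\to 0$ as $s\to+\infty$ and as $s\to-\infty$. Nonzero means not identically zero. $\|u\|_\infty=\sup_{s\in\mathbb{R}}|u(s)|$. The convergence $L(f,c)\to\infty$ is understood in $(0,\infty]$, i.e. for every $M>0$ one has $L(f,c)\ge M$ for all sufficiently small $|c|>0$. *)

theory Defs
  imports "HOL-Analysis.Analysis"
begin

text \<open>The supremum is taken in \<^typ>\<open>ereal\<close>, since the set may be unbounded, in which case
  the value is \<open>\<infinity>\<close>.\<close>

definition L :: "(real \<Rightarrow> real) \<Rightarrow> real \<Rightarrow> ereal" where
  "L f c = Sup (ereal ` {\<delta>. \<delta> > 0 \<and> (\<forall>v. 0 \<noteq> \<bar>v\<bar> \<and> \<bar>v\<bar> < \<delta> \<longrightarrow> f v / v > c ^ 4 / 4)})"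

text \<open>\<^const>\<open>deriv\<close> is a total function, so differentiability has to be required separately
  at every order.\<close>

definition C4 :: "(real \<Rightarrow> real) \<Rightarrow> bool" where
  "C4 u \<longleftrightarrow> (\<forall>k<4. \<forall>s. ((deriv ^^ k) u) differentiable (at s)) \<and>
     continuous_on UNIV ((deriv ^^ 4) u)"

definition homoclinic_solution :: "(real \<Rightarrow> real) \<Rightarrow> real \<Rightarrow> (real \<Rightarrow> real) \<Rightarrow> bool" where
  "homoclinic_solution f c u \<longleftrightarrow>
     C4 u \<and>
     (\<forall>s. (deriv ^^ 4) u s + c\<^sup>2 * (deriv ^^ 2) u s + f (u s) = 0) \<and>
     (u \<longlongrightarrow> 0) at_top \<and> (u \<longlongrightarrow> 0) at_bot"

definition sup_norm :: "(real \<Rightarrow> real) \<Rightarrow> ereal" where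
  "sup_norm u = (SUP s. ereal \<bar>u s\<bar>)"

end

theory Submission
  imports Defs
begin

text \<open>Along a solution, \<open>H = u''' u - u'' u'\<close> satisfies
  \<open>H' = - (u'' + c\<^sup>2 u / 2)\<^sup>2 - (u f(u) - c\<^sup>4 u\<^sup>2 / 4)\<close>.  If \<open>f(v) / v > c\<^sup>4 / 4\<close> on the
  range of \<open>u\<close>, then \<open>H\<close> is nonincreasing, and strictly decreasing near every point where
  \<open>u\<close> does not vanish.  But \<open>H\<close> tends to \<open>0\<close> at both ends for a homoclinic solution, because
  \<open>u\<close> and \<open>(u'' + c\<^sup>2 u)'' = - f(u)\<close> tend to \<open>0\<close>, and these control the intermediate derivatives.
  Finally, \<open>f(v) / v\<close> extends continuously to \<open>0\<close> by \<open>f'(0)\<close>, so it is bounded below by a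
  positive constant on every bounded interval.\<close>

section \<open>Interpolation: control of the intermediate derivatives\<close>

text \<open>Mean value theorem: the increment of \<open>g\<close> is at most \<open>2 * d\<close>,
  and dividing by a length of at least 1 does not enlarge it.\<close>

lemma small_derivative_between:
  fixes g g' :: "real \<Rightarrow> real"
  assumes "\<And>t. (g has_real_derivative g' t) (at t)"
    and "a + 1 \<le> b" "\<bar>g a\<bar> \<le> d" "\<bar>g b\<bar> \<le> d"
  shows "\<exists>t. a < t \<and> t < b \<and> \<bar>g' t\<bar> \<le> 2 * d"
proof -
  obtain t where t: "a < t" "t < b" "g b - g a = (b - a) * g' t"
    using MVT2[of a b g g'] assms by auto
  have "1 * \<bar>g' t\<bar> \<le> (b - a) * \<bar>g' t\<bar>"
    using assms(2) by (intro mult_right_mono) auto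
  also have "\<dots> = \<bar>g b - g a\<bar>"
    using t(3) assms(2) by (simp add: abs_mult)
  also have "\<dots> \<le> 2 * d"
    using assms(3,4) by linarith
  finally show ?thesis
    using t by auto
qed

lemma bound_from_point:
  fixes g g' :: "real \<Rightarrow> real"
  assumes "\<And>t. (g has_real_derivative g' t) (at t)"
    and "\<And>t. t \<in> {a..b} \<Longrightarrow> \<bar>g' t\<bar> \<le> d"
    and "p \<in> {a..b}" "x \<in> {a..b}" "\<bar>g p\<bar> \<le> m"
  shows "\<bar>g x\<bar> \<le> m + (b - a) * d"
proof -
  have "norm (g x - g p) \<le> d * norm (x - p)"
    using assms(1,2,3,4)
    by (intro field_differentiable_bound[of "{a..b}" g g'])
       (auto intro: has_field_derivative_at_within)
  moreover have "d * norm (x - p) \<le> d * (b - a)"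
    using assms(3,4) order_trans[OF abs_ge_zero assms(2)[OF assms(3)]]
    by (intro mult_left_mono) auto
  ultimately show ?thesis
    using assms(5) by (simp add: mult.commute)
qed

text \<open>With \<open>y = u2 + k * u\<close>, the second bounded quantity is \<open>y''\<close>.
  The mean value theorem gives points of the window where \<open>u1\<close>, then \<open>y\<close>,
  then \<open>y'\<close> is small; integrating back from them bounds \<open>y'\<close>,
  \<open>y\<close>, \<open>u2\<close>, \<open>u1\<close> and \<open>u3\<close> in turn. The constant
  depends on \<open>k\<close> only, so that \<open>e\<close> may later tend to 0.\<close>

lemma derivative_bounds:
  fixes u u1 u2 u3 u4 :: "real \<Rightarrow> real" and k :: real
  assumes d0: "\<And>t. (u has_real_derivative u1 t) (at t)"
    and d1: "\<And>t. (u1 has_real_derivative u2 t) (at t)"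
    and d2: "\<And>t. (u2 has_real_derivative u3 t) (at t)"
    and d3: "\<And>t. (u3 has_real_derivative u4 t) (at t)"
    and k: "k \<ge> 0"
  shows "\<exists>C>0. \<forall>e s. (\<forall>t\<in>{s..s+7}. \<bar>u t\<bar> \<le> e \<and> \<bar>u4 t + k * u2 t\<bar> \<le> e) \<longrightarrow>
           \<bar>u1 s\<bar> \<le> C * e \<and> \<bar>u2 s\<bar> \<le> C * e \<and> \<bar>u3 s\<bar> \<le> C * e"
proof -
  \<comment> \<open>These collect the bounds below: \<open>u2 = y - k * u\<close>; \<open>u1\<close>
    is at most \<open>2 * e\<close> at some point and has derivative \<open>u2\<close>;
    \<open>u3 = y' - k * u1\<close>. Each factor 7 is the length of the window.\<close>
  define B2 where "B2 = 4 + k + 7 * (15 + 2 * k) + k"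
  define B1 where "B1 = 2 + 7 * B2"
  define B3 where "B3 = 15 + 2 * k + k * B1"
  have pos: "B1 > 0" "B2 > 0" "B3 > 0"
    using k by (auto simp: B1_def B2_def B3_def intro!: add_pos_nonneg)
  let ?y = "\<lambda>t. u2 t + k * u t" and ?y1 = "\<lambda>t. u3 t + k * u1 t"
  have dy: "(?y has_real_derivative ?y1 t) (at t)" for t
    by (auto intro!: derivative_eq_intros d0 d2)
  have dy1: "(?y1 has_real_derivative u4 t + k * u2 t) (at t)" for t
    by (auto intro!: derivative_eq_intros d1 d3)
  have "\<bar>u1 s\<bar> \<le> B1 * e \<and> \<bar>u2 s\<bar> \<le> B2 * e \<and> \<bar>u3 s\<bar> \<le> B3 * e"
    if h: "\<forall>t\<in>{s..s+7}. \<bar>u t\<bar> \<le> e \<and> \<bar>u4 t + k * u2 t\<bar> \<le> e" for e s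
  proof -
    have small1: "\<exists>t. a < t \<and> t < a + 1 \<and> \<bar>u1 t\<bar> \<le> 2 * e" if "s \<le> a" "a \<le> s + 6" for a
      using small_derivative_between[OF d0, of a "a + 1" e] h that by auto
    have small2: "\<exists>t. a < t \<and> t < a + 3 \<and> \<bar>?y t\<bar> \<le> (4 + k) * e" if a: "s \<le> a" "a \<le> s + 4" for a
    proof -
      \<comment> \<open>The points lie in the outer thirds of an interval of length 3, hence at
        distance more than 1, as the mean value step for \<open>u1\<close> requires.\<close>
      obtain t1 t2 where t: "a < t1" "t1 < a + 1" "\<bar>u1 t1\<bar> \<le> 2 * e"
        "a + 2 < t2" "t2 < a + 3" "\<bar>u1 t2\<bar> \<le> 2 * e"
        using small1[of a] small1[of "a + 2"] a by force
      then obtain p where p: "t1 < p" "p < t2" "\<bar>u2 p\<bar> \<le> 2 * (2 * e)"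
        using small_derivative_between[OF d1, of t1 t2 "2 * e"] by auto
      have "\<bar>k * u p\<bar> \<le> k * e"
        using h p t a k by (auto simp: abs_mult intro!: mult_left_mono)
      then have "\<bar>?y p\<bar> \<le> (4 + k) * e"
        using p(3) by (simp add: algebra_simps)
      then show ?thesis using p t by (intro exI[of _ p]) auto
    qed
    \<comment> \<open>Two intervals of length 3 separated by a gap of 1 make up the window length
      7.\<close>
    obtain p q where pq: "s < p" "p < s + 3" "\<bar>?y p\<bar> \<le> (4 + k) * e"
      "s + 4 < q" "q < s + 7" "\<bar>?y q\<bar> \<le> (4 + k) * e"
      using small2[of s] small2[of "s + 4"] by force
    then obtain r where r: "p < r" "r < q" "\<bar>?y1 r\<bar> \<le> 2 * ((4 + k) * e)"
      using small_derivative_between[OF dy, of p q "(4 + k) * e"] by auto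
    \<comment> \<open>Here \<open>15 + 2 * k\<close> is \<open>2 * (4 + k)\<close> at
      \<open>r\<close> plus \<open>7 * 1\<close> from the bound \<open>e\<close> on
      \<open>y''\<close>.\<close>
    have y1: "\<bar>?y1 x\<bar> \<le> (15 + 2 * k) * e" if "x \<in> {s..s+7}" for x
      using bound_from_point[OF dy1, of s "s + 7" e r x "2 * ((4 + k) * e)"] h that pq r by (auto simp: algebra_simps)
    have y0: "\<bar>?y x\<bar> \<le> (4 + k + 7 * (15 + 2 * k)) * e" if "x \<in> {s..s+7}" for x
      using bound_from_point[OF dy, of s "s + 7" "(15 + 2 * k) * e" p x "(4 + k) * e"] y1 that pq
      by (auto simp: algebra_simps)
    have u2: "\<bar>u2 x\<bar> \<le> B2 * e" if "x \<in> {s..s+7}" for x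
    proof -
      have "\<bar>k * u x\<bar> \<le> k * e"
        using h that k by (auto simp: abs_mult intro!: mult_left_mono)
      then show ?thesis
        using y0[OF that] by (simp add: B2_def algebra_simps)
    qed
    obtain t where t: "s < t" "t < s + 1" "\<bar>u1 t\<bar> \<le> 2 * e"
      using small1[of s] by auto
    have u1: "\<bar>u1 s\<bar> \<le> B1 * e"
      using bound_from_point[OF d1, of s "s + 7" "B2 * e" t s "2 * e"] u2 t by (auto simp: B1_def algebra_simps)
    have "\<bar>k * u1 s\<bar> \<le> k * (B1 * e)"
      using u1 k by (auto simp: abs_mult intro!: mult_left_mono)
    then have "\<bar>u3 s\<bar> \<le> B3 * e"
      using y1[of s] by (simp add: B3_def algebra_simps)
    then show ?thesis
      using u1 u2[of s] by auto
  qed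
  note bounds = this
  show ?thesis
  proof (intro exI[of _ "B1 + B2 + B3"] conjI allI impI)
    fix e s assume h: "\<forall>t\<in>{s..s+7}. \<bar>u t\<bar> \<le> e \<and> \<bar>u4 t + k * u2 t\<bar> \<le> e"
    then have "\<bar>u s\<bar> \<le> e" by simp
    \<comment> \<open>Nonnegativity of \<open>e\<close> allows each single constant to be replaced
      by the sum.\<close>
    then have "0 \<le> e" by linarith
    then have "B1 * e \<ge> 0" "B2 * e \<ge> 0" "B3 * e \<ge> 0"
      using pos by auto
    then show "\<bar>u1 s\<bar> \<le> (B1 + B2 + B3) * e" "\<bar>u2 s\<bar> \<le> (B1 + B2 + B3) * e"
      "\<bar>u3 s\<bar> \<le> (B1 + B2 + B3) * e"
      using bounds[OF h] unfolding distrib_right by linarith+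
  qed (use pos in auto)
qed

text \<open>The abstract filter with its hypothesis \<open>window\<close> lets one argument serve
  both ends of the line.\<close>

lemma derivatives_tendsto_0:
  fixes u u1 u2 u3 u4 :: "real \<Rightarrow> real" and k :: real
  assumes d: "\<And>t. (u has_real_derivative u1 t) (at t)"
    "\<And>t. (u1 has_real_derivative u2 t) (at t)"
    "\<And>t. (u2 has_real_derivative u3 t) (at t)"
    "\<And>t. (u3 has_real_derivative u4 t) (at t)"
    and k: "k \<ge> 0"
    and window: "\<And>P. eventually P F \<Longrightarrow> eventually (\<lambda>s. \<forall>t\<in>{s..s+7}. P t) F"
    and lim: "(u \<longlongrightarrow> 0) F" "((\<lambda>t. u4 t + k * u2 t) \<longlongrightarrow> 0) F"
  shows "(u1 \<longlongrightarrow> 0) F" "(u2 \<longlongrightarrow> 0) F" "(u3 \<longlongrightarrow> 0) F"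
proof -
  obtain C where C: "C > 0" and bounds:
    "\<And>e s. \<forall>t\<in>{s..s+7}. \<bar>u t\<bar> \<le> e \<and> \<bar>u4 t + k * u2 t\<bar> \<le> e \<Longrightarrow>
       \<bar>u1 s\<bar> \<le> C * e \<and> \<bar>u2 s\<bar> \<le> C * e \<and> \<bar>u3 s\<bar> \<le> C * e"
    using derivative_bounds[OF d k] by blast
  have ev: "eventually (\<lambda>s. \<bar>u1 s\<bar> < e \<and> \<bar>u2 s\<bar> < e \<and> \<bar>u3 s\<bar> < e) F" if e: "e > 0" for e
  proof -
    define d where "d = e / (2 * C)"
    have d: "d > 0" "C * d < e"
      using e C by (auto simp: d_def)
    have "eventually (\<lambda>t. \<bar>u t\<bar> \<le> d \<and> \<bar>u4 t + k * u2 t\<bar> \<le> d) F"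
      using tendstoD[OF lim(1) d(1)] tendstoD[OF lim(2) d(1)] by eventually_elim auto
    from window[OF this] show ?thesis
    proof eventually_elim
      case (elim s)
      then show ?case
        using bounds[OF elim] d(2) by auto
    qed
  qed
  show "(u1 \<longlongrightarrow> 0) F" "(u2 \<longlongrightarrow> 0) F" "(u3 \<longlongrightarrow> 0) F"
    by (rule tendstoI, drule ev, erule eventually_mono, simp)+
qed

lemma eventually_window_at_top:
  assumes "eventually P (at_top :: real filter)"
  shows "eventually (\<lambda>s. \<forall>t\<in>{s..s+7}. P t) at_top"
  using assms unfolding eventually_at_top_linorder by (meson atLeastAtMost_iff order_trans)

lemma eventually_window_at_bot:
  assumes "eventually P (at_bot :: real filter)"
  shows "eventually (\<lambda>s. \<forall>t\<in>{s..s+7}. P t) at_bot"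
proof -
  obtain N where N: "\<And>t. t \<le> N \<Longrightarrow> P t"
    using assms unfolding eventually_at_bot_linorder by auto
  show ?thesis
    \<comment> \<open>The shift by 7 keeps the right end of the window below
      \<open>N\<close>.\<close>
    unfolding eventually_at_bot_linorder by (rule exI[of _ "N - 7"]) (auto intro!: N)
qed

section \<open>Rigidity: the monotone quantity \<open>H\<close>\<close>

text \<open>The quotient condition is imposed only on values taken by \<open>u\<close>, so that a
  bound on the sup norm suffices to apply it.\<close>

lemma homoclinic_eq_zero:
  fixes f u :: "real \<Rightarrow> real"
  assumes hom: "homoclinic_solution f c u"
    and cont: "isCont f 0" and f0: "f 0 = 0"
    and gt: "\<And>s. u s \<noteq> 0 \<Longrightarrow> f (u s) / u s > c ^ 4 / 4"
  shows "u s = 0"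
proof -
  define u1 where "u1 = (deriv ^^ 1) u"
  define u2 where "u2 = (deriv ^^ 2) u"
  define u3 where "u3 = (deriv ^^ 3) u"
  define u4 where "u4 = (deriv ^^ 4) u"
  have step: "((deriv ^^ k) u has_real_derivative (deriv ^^ j) u t) (at t)"
    if "k < 4" "j = Suc k" for j k t
  proof -
    have "(deriv ^^ k) u differentiable (at t)"
      using hom that(1) unfolding homoclinic_solution_def C4_def by blast
    then show ?thesis
      unfolding that(2) by (simp add: DERIV_deriv_iff_real_differentiable)
  qed
  have d0: "(u has_real_derivative u1 t) (at t)" for t
    using step[of 0 1 t] by (simp add: u1_def)
  have d1: "(u1 has_real_derivative u2 t) (at t)" for t
    unfolding u1_def u2_def by (rule step) auto
  have d2: "(u2 has_real_derivative u3 t) (at t)" for t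
    unfolding u2_def u3_def by (rule step) auto
  have d3: "(u3 has_real_derivative u4 t) (at t)" for t
    unfolding u3_def u4_def by (rule step) auto
  have eq: "u4 t + c\<^sup>2 * u2 t = - f (u t)" for t
  proof -
    have "u4 t + c\<^sup>2 * u2 t + f (u t) = 0"
      using hom unfolding homoclinic_solution_def u4_def u2_def by blast
    then show ?thesis by linarith
  qed
  define H where "H t = u3 t * u t - u2 t * u1 t" for t
  define H' where "H' t = - (u2 t + c\<^sup>2 / 2 * u t)\<^sup>2 - (u t * f (u t) - c ^ 4 / 4 * (u t)\<^sup>2)" for t
  have dH: "(H has_real_derivative H' t) (at t)" for t
  proof -
    have "(H has_real_derivative u4 t * u t + u3 t * u1 t - (u3 t * u1 t + u2 t * u2 t)) (at t)"
      unfolding H_def by (auto intro!: derivative_eq_intros d0 d1 d2 d3)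
    moreover have u4_eq: "u4 t = - f (u t) - c\<^sup>2 * u2 t"
      using eq[of t] by linarith
    have "u4 t * u t + u3 t * u1 t - (u3 t * u1 t + u2 t * u2 t) = H' t"
      \<comment> \<open>The \<open>u3 * u1\<close> terms cancel; completing the square in
        \<open>u2\<close> produces the term with \<open>c ^ 4 / 4\<close>.\<close>
      unfolding H'_def u4_eq by (simp add: power2_eq_square power4_eq_xxxx field_simps)
    ultimately show ?thesis by simp
  qed
  have strict: "H' t < 0" if "u t \<noteq> 0" for t
  proof -
    have "c ^ 4 / 4 * (u t)\<^sup>2 < f (u t) / u t * (u t)\<^sup>2"
      using gt[OF that] that by (intro mult_strict_right_mono) auto
    also have "\<dots> = u t * f (u t)"
      using that by (simp add: power2_eq_square)
    finally show ?thesis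
      using zero_le_power2[of "u2 t + c\<^sup>2 / 2 * u t"] unfolding H'_def by linarith
  qed
  \<comment> \<open>At a zero of \<open>u\<close> only \<open>- (u2 t)\<^sup>2\<close>
    remains.\<close>
  have nonpos: "H' t \<le> 0" for t
    using strict[of t] by (cases "u t = 0") (auto simp: H'_def f0)
  have anti: "H b \<le> H a" if "a \<le> b" for a b
    using that by (rule DERIV_nonpos_imp_nonincreasing) (use dH nonpos in blast)
  have lim: "(H \<longlongrightarrow> 0) F"
    if F: "(u \<longlongrightarrow> 0) F"
      "\<And>P. eventually P F \<Longrightarrow> eventually (\<lambda>s. \<forall>t\<in>{s..s+7}. P t) F" for F
  proof -
    have "((\<lambda>t. - f (u t)) \<longlongrightarrow> - f 0) F"
      by (intro tendsto_minus isCont_tendsto_compose[OF cont] F(1))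
    then have "((\<lambda>t. u4 t + c\<^sup>2 * u2 t) \<longlongrightarrow> 0) F"
      by (simp add: eq f0)
    note deriv_lims = derivatives_tendsto_0[OF d0 d1 d2 d3 zero_le_power2 F(2) F(1) this]
    have "(H \<longlongrightarrow> 0 * 0 - 0 * 0) F"
      unfolding H_def by (intro tendsto_intros deriv_lims F(1))
    then show ?thesis by simp
  qed
  have u_lim: "(u \<longlongrightarrow> 0) at_top" "(u \<longlongrightarrow> 0) at_bot"
    using hom unfolding homoclinic_solution_def by blast+
  have lim_top: "(H \<longlongrightarrow> 0) at_top"
    by (rule lim[OF u_lim(1) eventually_window_at_top])
  have lim_bot: "(H \<longlongrightarrow> 0) at_bot"
    by (rule lim[OF u_lim(2) eventually_window_at_bot])
  \<comment> \<open>A nonincreasing function lies between its limits at the two ends, and both are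
    0.\<close>
  have "H t = 0" for t
  proof (rule antisym)
    show "H t \<le> 0"
      using lim_bot by (rule tendsto_lowerbound)
        (auto simp: eventually_at_bot_linorder intro!: exI[of _ t] anti)
    show "0 \<le> H t"
      using lim_top by (rule tendsto_upperbound)
        (auto simp: eventually_at_top_linorder intro!: exI[of _ t] anti)
  qed
  then have "H = (\<lambda>_. 0)" by auto
  then have "H' s = 0"
    using DERIV_unique[OF dH[of s], of 0] by simp
  then show ?thesis
    using strict[of s] by auto
qed

section \<open>Consequences of the hypotheses on \<open>f\<close>\<close>

text \<open>The sign condition makes \<open>f\<close> nonnegative right of 0 and nonpositive left of
  it; the one-sided limits then squeeze \<open>f 0\<close>.\<close>

lemma zero_of_sign_condition:
  fixes f :: "real \<Rightarrow> real"
  assumes cont: "isCont f 0" and sign: "\<And>u. u \<noteq> 0 \<Longrightarrow> u * f u > 0"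
  shows "f 0 = 0"
proof -
  have lim: "(f \<longlongrightarrow> f 0) (at_right 0)" "(f \<longlongrightarrow> f 0) (at_left 0)"
    using cont unfolding isCont_def filterlim_at_split by auto
  have "f x \<ge> 0" if "x > 0" for x
    using sign[of x] that by (simp add: zero_less_mult_iff)
  then have "eventually (\<lambda>x. f x \<ge> 0) (at_right 0)"
    by (auto simp: eventually_at_filter)
  then have "f 0 \<ge> 0"
    using tendsto_lowerbound[OF lim(1)] by simp
  have "f x \<le> 0" if "x < 0" for x
    using sign[of x] that by (simp add: zero_less_mult_iff)
  then have "eventually (\<lambda>x. f x \<le> 0) (at_left 0)"
    by (auto simp: eventually_at_filter)
  then have "f 0 \<le> 0"
    using tendsto_upperbound[OF lim(2)] by simp
  with \<open>f 0 \<ge> 0\<close> show ?thesis by simp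
qed

text \<open>The quotient, extended to 0 by its limit, is continuous and positive, so it attains a
  positive minimum on the compact interval from \<open>-M\<close> to \<open>M\<close>.\<close>

lemma quotient_bounded_below:
  fixes f :: "real \<Rightarrow> real"
  assumes cont: "\<And>x. isCont f x" and sign: "\<And>u. u \<noteq> 0 \<Longrightarrow> u * f u > 0"
    and quot: "((\<lambda>v. f v / v) \<longlongrightarrow> f'0) (at 0)" "f'0 > 0" and M: "M > 0"
  shows "\<exists>m>0. \<forall>v. 0 \<noteq> \<bar>v\<bar> \<and> \<bar>v\<bar> < M \<longrightarrow> f v / v \<ge> m"
proof -
  define g where "g v = (if v = 0 then f'0 else f v / v)" for v
  have "isCont g x" for x
  proof (cases "x = 0")
    case True
    have "(g \<longlongrightarrow> f'0) (at 0)"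
      by (rule Lim_transform_eventually[OF quot(1)]) (auto simp: g_def eventually_at_filter)
    then show ?thesis
      by (simp add: True isCont_def g_def)
  next
    case False
    have "isCont (\<lambda>v. f v / v) x"
      using False by (intro continuous_intros cont) auto
    moreover have "eventually (\<lambda>v. v \<noteq> 0) (nhds x)"
      using False by (rule t1_space_nhds)
    then have "eventually (\<lambda>v. g v = f v / v) (nhds x)"
      by eventually_elim (simp add: g_def)
    ultimately show ?thesis
      using isCont_cong[of g "\<lambda>v. f v / v" x] by simp
  qed
  then have "continuous_on {-M..M} g"
    by (simp add: continuous_at_imp_continuous_on)
  then obtain x where x: "x \<in> {-M..M}" "\<And>v. v \<in> {-M..M} \<Longrightarrow> g x \<le> g v"
    using continuous_attains_inf[of "{-M..M}" g] M by auto
  have "g x > 0"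
    using sign[of x] quot(2) by (auto simp: g_def zero_less_mult_iff zero_less_divide_iff)
  moreover have "f v / v \<ge> g x" if "0 \<noteq> \<bar>v\<bar>" "\<bar>v\<bar> < M" for v
  proof -
    have "v \<in> {-M..M}"
      using that(2) by auto
    from x(2)[OF this] show ?thesis
      using that(1) by (simp add: g_def)
  qed
  ultimately show ?thesis by blast
qed

lemma L_ge:
  assumes "\<delta> > 0" "\<And>v. 0 \<noteq> \<bar>v\<bar> \<Longrightarrow> \<bar>v\<bar> < \<delta> \<Longrightarrow> f v / v > c ^ 4 / 4"
  shows "L f c \<ge> ereal \<delta>"
  unfolding L_def using assms by (intro Sup_upper) auto

section \<open>The limit of \<open>L\<close> and the blow-up of homoclinic solutions\<close>

theorem mainTheorem2:
  fixes f :: "real \<Rightarrow> real"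
  assumes "local_lipschitz (UNIV :: real set) UNIV (\<lambda>_. f)"
    and "\<And>u. u \<noteq> 0 \<Longrightarrow> u * f u > 0"
    and "f differentiable (at 0)"
    and "deriv f 0 > 0"
  shows "(\<forall>c. 0 < c ^ 4 \<and> c ^ 4 < 4 * deriv f 0 \<longrightarrow> 0 < L f c) \<and>
    (L f \<longlongrightarrow> \<infinity>) (at 0) \<and>
    (\<forall>M::real. M > 0 \<longrightarrow> (\<exists>c\<^sub>0>0. \<forall>c. 0 < \<bar>c\<bar> \<and> \<bar>c\<bar> < c\<^sub>0 \<longrightarrow>
       (\<forall>u. homoclinic_solution f c u \<and> u \<noteq> (\<lambda>_. 0) \<longrightarrow> sup_norm u \<ge> ereal M)))"
proof -
  have "continuous_on UNIV f"
    using local_lipschitz_continuous_on[OF assms(1)] by simp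
  then have cont: "isCont f x" for x
    by (simp add: continuous_on_eq_continuous_at)
  have f0: "f 0 = 0"
    using zero_of_sign_condition[OF cont assms(2)] .
  have "(f has_real_derivative deriv f 0) (at 0)"
    using assms(3) DERIV_deriv_iff_real_differentiable by blast
  then have quot: "((\<lambda>v. f v / v) \<longlongrightarrow> deriv f 0) (at 0)"
    by (simp add: has_field_derivative_iff f0)
  \<comment> \<open>The lower bound \<open>m\<close> does not depend on \<open>c\<close>, while
    \<open>c ^ 4 / 4\<close> tends to 0. Both the limit of \<open>L\<close> and the blow-up rest on
    this.\<close>
  have small_c: "eventually (\<lambda>c. \<forall>v. 0 \<noteq> \<bar>v\<bar> \<and> \<bar>v\<bar> < M \<longrightarrow> f v / v > c ^ 4 / 4) (at 0)"
    if M: "M > 0" for M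
  proof -
    obtain m where m: "m > 0" "\<forall>v. 0 \<noteq> \<bar>v\<bar> \<and> \<bar>v\<bar> < M \<longrightarrow> f v / v \<ge> m"
      using quotient_bounded_below[OF cont assms(2) quot assms(4) M] by auto
    have "((\<lambda>c::real. c ^ 4 / 4) \<longlongrightarrow> 0 ^ 4 / 4) (at 0)"
      by (intro tendsto_intros) auto
    then have "eventually (\<lambda>c. c ^ 4 / 4 < m) (at 0)"
      using m(1) by (auto dest: order_tendstoD(2))
    then show ?thesis
      by eventually_elim (use m(2) less_le_trans in blast)
  qed
  show ?thesis
  proof (intro conjI allI impI)
    fix c :: real assume "0 < c ^ 4 \<and> c ^ 4 < 4 * deriv f 0"
    \<comment> \<open>The assumption puts \<open>c ^ 4 / 4\<close> strictly below the limit of the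
      quotient at 0.\<close>
    then have "eventually (\<lambda>v. f v / v > c ^ 4 / 4) (at 0)"
      using order_tendstoD(1)[OF quot, of "c ^ 4 / 4"] by auto
    then obtain \<delta> where "\<delta> > 0" "\<And>v. v \<noteq> 0 \<Longrightarrow> \<bar>v\<bar> < \<delta> \<Longrightarrow> f v / v > c ^ 4 / 4"
      unfolding eventually_at by (auto simp: dist_real_def)
    then have "ereal \<delta> \<le> L f c" "0 < ereal \<delta>"
      using L_ge[of \<delta> c f] by auto
    then show "0 < L f c"
      by (rule less_le_trans[rotated])
  next
    show "(L f \<longlongrightarrow> \<infinity>) (at 0)"
      unfolding tendsto_PInfty
    proof
      fix r :: real
      \<comment> \<open>A radius that is positive and exceeds \<open>r\<close> strictly, whatever
        the sign of \<open>r\<close>.\<close>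
      have "\<bar>r\<bar> + 1 > 0" by linarith
      from small_c[OF this] show "eventually (\<lambda>c. ereal r < L f c) (at 0)"
      proof eventually_elim
        case (elim c)
        then have "ereal (\<bar>r\<bar> + 1) \<le> L f c"
          by (intro L_ge) auto
        moreover have "ereal r < ereal (\<bar>r\<bar> + 1)" by simp
        ultimately show ?case by (rule less_le_trans[rotated])
      qed
    qed
  next
    fix M :: real assume "M > 0"
    from small_c[OF this] obtain c0 where c0: "c0 > 0"
      "\<And>c v. c \<noteq> 0 \<Longrightarrow> \<bar>c\<bar> < c0 \<Longrightarrow> 0 \<noteq> \<bar>v\<bar> \<Longrightarrow> \<bar>v\<bar> < M \<Longrightarrow> f v / v > c ^ 4 / 4"
      unfolding eventually_at by (auto simp: dist_real_def)
    have "sup_norm u \<ge> ereal M"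
      if c: "0 < \<bar>c\<bar>" "\<bar>c\<bar> < c0" and u: "homoclinic_solution f c u" "u \<noteq> (\<lambda>_. 0)" for c u
    proof (rule ccontr)
      \<comment> \<open>All values of \<open>u\<close> then lie in the range where the quotient
        exceeds \<open>c ^ 4 / 4\<close>, which forces \<open>u\<close> to vanish.\<close>
      assume "\<not> sup_norm u \<ge> ereal M"
      moreover have "ereal \<bar>u s\<bar> \<le> sup_norm u" for s
        unfolding sup_norm_def by (rule SUP_upper) simp
      ultimately have "ereal \<bar>u s\<bar> < ereal M" for s
        by (meson le_less_trans not_le)
      then have "f (u s) / u s > c ^ 4 / 4" if "u s \<noteq> 0" for s
        using c0(2)[of c "u s"] c that by auto
      then have "u = (\<lambda>_. 0)"
        using homoclinic_eq_zero[OF u(1) cont f0] by blast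
      with u(2) show False by contradiction
    qed
    with c0(1) show "\<exists>c\<^sub>0>0. \<forall>c. 0 < \<bar>c\<bar> \<and> \<bar>c\<bar> < c\<^sub>0 \<longrightarrow>
       (\<forall>u. homoclinic_solution f c u \<and> u \<noteq> (\<lambda>_. 0) \<longrightarrow> sup_norm u \<ge> ereal M)"
      by blast
  qed
qed

end
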